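(* Let $K \subseteq \mathbb{R}^n$ be a nonempty compact connected set satisfying the following geometric condition: there exist constants $\epsilon_K > 0$, $\eta_K > 0$ and $N \geq n$ such that, for all $x \in K$ and all $0 < \delta \leq \epsilon_K$, $$\mathrm{vol}\left(K \cap B^n_\delta(x)\right) \geq \eta_K\, \delta^N\, \mathrm{vol}(B^n).$$ Let $f \in \mathbb{R}[x]$ be an $n$-variate polynomial. Then $$f^{(r)}_{\mathrm{pfm}} - f_{\min} = O\left(\frac{\log^2 r}{r^2}\right) \quad \text{as } r \to \infty.$$
   Context: Here $\mathrm{vol}$ is Lebesgue measure, $B^n_\delta(x)$ is the Euclidean ball in $\mathbb{R}^n$ centered at $x$ with radius $\delta$, and $B^n = B^n_1(0)$. Set $f_{\min} = \min_{x \in K} f(x)$. Let $\lambda$ be the Lebesgue measure on $K$. Let $\Sigma[t]_r$ denote the set of univariate real polynomials of degree at most $2r$ that can be written as a sum of squares of real polynomials. For $r \in \mathbb{N}$ define $$f^{(r)}_{\mathrm{pfm}} := \min\left\{ \int_K f(x)\, s(f(x))\, d\lambda(x) \;:\; s \in \Sigma[t]_r,\ \int_K s(f(x))\, d\lambda(x) = 1 \right\}.$$ Equivalently, $f^{(r)}_{\mathrm{pfm}} = \min\{ \int_{f(K)} t\, s(t)\, d\lambda_f(t) : s \in \Sigma[t]_r,\ \int_{f(K)} s(t)\, d\lambda_f(t) = 1\}$, where $\lambda_f$ is the push-forward measure $\lambda_f(B) = \lambda(f^{-1}(B))$ for Borel sets $B \subseteq \mathbb{R}$. The notation $\log^2 r$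 means $(\log r)^2$, and the constant implied by $O(\cdot)$ may depend on $K$ and $f$ but not on $r$. *)

theory Defs
  imports
    "HOL-Analysis.Analysis"
    "HOL-Library.Landau_Symbols"
    "HOL-Computational_Algebra.Polynomial"
begin

definition sos_polys :: "nat \<Rightarrow> real poly set" where
  "sos_polys r = {s. degree s \<le> 2 * r \<and> (\<exists>ps. s = (\<Sum>p\<leftarrow>ps. p\<^sup>2))}"

text \<open>
  The minima are rendered by \<open>LEAST\<close>, which returns the minimum of a set of reals when
  there is one and is unspecified otherwise; it does not coincide with the infimum of a
  set that has no minimum.
\<close>

definition fmin :: "(real ^ 'n) set \<Rightarrow> (real ^ 'n \<Rightarrow> real) \<Rightarrow> real" where
  "fmin K f = (LEAST v. v \<in> f ` K)"

definition pfm :: "(real ^ 'n) set \<Rightarrow> (real ^ 'n \<Rightarrow> real) \<Rightarrow> nat \<Rightarrow> real" where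
  "pfm K f r =
     (LEAST v. v \<in> {(LINT x|lebesgue_on K. f x * poly s (f x)) | s.
                      s \<in> sos_polys r \<and> (LINT x|lebesgue_on K. poly s (f x)) = 1})"

end

theory Submission
  imports Defs
begin

text \<open>
  Let \<open>[a, b]\<close> be the range of \<open>f\<close> on \<open>K\<close> and compose the Chebyshev polynomial \<open>T\<^sub>r\<close> with the
  affine map that sends \<open>[a + h, b]\<close> to \<open>[-1, 1]\<close>. The square of the result is at most 1 on
  \<open>[a + h, b]\<close> but of order \<open>exp (c * r * sqrt h)\<close> on \<open>[a, a + h / 2]\<close>. Since \<open>f\<close> is Lipschitz, the
  geometric condition gives the sublevel set \<open>f \<le> a + h / 2\<close> a volume of order at least
  \<open>h powr N\<close>, so the normalised square has objective value at most
  \<open>a + h + C * h powr (- N) * exp (- c * r * sqrt h)\<close>. Taking \<open>h\<close> to be a large multiple of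
  \<open>(ln r / r)\<^sup>2\<close> makes the last term negligible.
\<close>

subsection \<open>Minimising a linear functional over normalised sums of squares\<close>

text \<open>A square reaches degree \<open>2 * d\<close> only when its base has degree exactly
  \<open>d\<close>; for smaller degrees both sides contribute 0.\<close>

lemma coeff_square_sum_list_top:
  fixes ps :: "'a::comm_semiring_1 poly list"
  assumes "\<And>p. p \<in> set ps \<Longrightarrow> degree p \<le> d"
  shows "coeff (\<Sum>p\<leftarrow>ps. p\<^sup>2) (2 * d) = (\<Sum>p\<leftarrow>ps. (coeff p d)\<^sup>2)"
  using assms
proof (induction ps)
  case Nil
  then show ?case by simp
next
  case (Cons p ps)
  have "coeff (p\<^sup>2) (2 * d) = (coeff p d)\<^sup>2"
  proof (cases "degree p = d")
    case True
    then show ?thesis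
      using coeff_mult_degree_sum[of p p] by (simp add: power2_eq_square mult_2)
  next
    case False
    with Cons.prems have "degree p < d" by (simp add: order_less_le)
    moreover have "degree (p\<^sup>2) \<le> degree p * 2" by (rule degree_power_le)
    ultimately show ?thesis by (simp add: coeff_eq_0)
  qed
  with Cons show ?case by simp
qed

text \<open>Leading coefficients of real squares are positive and cannot cancel: a summand of
  maximal degree \<open>d > r\<close> would leave a nonzero coefficient in degree
  \<open>2 * d\<close>.\<close>

lemma degree_le_of_sum_list_squares:
  fixes ps :: "real poly list"
  assumes deg: "degree (\<Sum>p\<leftarrow>ps. p\<^sup>2) \<le> 2 * r" and p: "p \<in> set ps"
  shows "degree p \<le> r"
proof (rule ccontr)
  assume "\<not> degree p \<le> r"
  define d where "d = Max (degree ` set ps)"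
  have le: "degree q \<le> d" if "q \<in> set ps" for q
    using that by (simp add: d_def)
  have "d \<in> degree ` set ps"
    unfolding d_def using p by (intro Max_in) auto
  then obtain q where q: "q \<in> set ps" "degree q = d" by auto
  have "r < d" using \<open>\<not> degree p \<le> r\<close> le[OF p] by simp
  with q have "0 < (coeff q d)\<^sup>2" by auto
  moreover have "(coeff q d)\<^sup>2 \<le> (\<Sum>p\<leftarrow>ps. (coeff p d)\<^sup>2)"
    using q(1) by (intro member_le_sum_list) auto
  moreover have "(\<Sum>p\<leftarrow>ps. (coeff p d)\<^sup>2) = 0"
    using \<open>r < d\<close> deg by (simp flip: coeff_square_sum_list_top[OF le] add: coeff_eq_0)
  ultimately show False by simp
qed

lemma smult_square_in_sos_polys:
  assumes "degree p \<le> r" "c \<ge> 0"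
  shows "smult c (p\<^sup>2) \<in> sos_polys r"
proof -
  have "smult c (p\<^sup>2) = (smult (sqrt c) p)\<^sup>2"
    using assms(2) by (simp add: power2_eq_square)
  moreover have "degree (smult c (p\<^sup>2)) \<le> 2 * r"
    using assms(1) degree_smult_le[of c "p\<^sup>2"] degree_power_le[of p 2] by simp
  ultimately show ?thesis
    by (auto simp: sos_polys_def intro!: exI[of _ "[smult (sqrt c) p]"])
qed

text \<open>Abstracts the two functionals of the minimisation: the integral of \<open>p\<close>
  composed with \<open>f\<close>, with weight 1 for the constraint and with weight \<open>f\<close>
  for the objective.\<close>

locale poly_functional =
  fixes L :: "real poly \<Rightarrow> real"
  assumes add: "L (p + q) = L p + L q" and smult: "L (smult c p) = c * L p"
begin

lemma zero: "L 0 = 0"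
  using smult[of 0 0] by simp

lemma sum: "L (\<Sum>i\<in>A. g i) = (\<Sum>i\<in>A. L (g i))"
  by (induction A rule: infinite_finite_induct) (auto simp: zero add)

lemma sum_list: "L (\<Sum>p\<leftarrow>ps. g p) = (\<Sum>p\<leftarrow>ps. L (g p))"
  by (induction ps) (auto simp: zero add)

lemma smult_square: "L ((Polynomial.smult c p)\<^sup>2) = c\<^sup>2 * L (p\<^sup>2)"
  by (simp add: power2_eq_square smult)

text \<open>The Hankel form of the moments of \<open>L\<close>: a polynomial in finitely many
  coefficients, hence continuous in them.\<close>

lemma square_expand:
  "L ((\<Sum>i\<le>r. monom (c i) i)\<^sup>2) = (\<Sum>i\<le>r. \<Sum>j\<le>r. c i * c j * L (monom 1 (i + j)))"
proof -
  have "monom (c i) i * monom (c j) j = Polynomial.smult (c i * c j) (monom 1 (i + j))" for i j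
    by (simp add: mult_monom smult_monom)
  then show ?thesis
    by (simp add: power2_eq_square sum_product sum smult)
qed

lemma continuous_on_square: "continuous_on S (\<lambda>c. L ((\<Sum>i\<le>r. monom (c i) i)\<^sup>2))"
  unfolding square_expand
  by (intro continuous_intros continuous_on_subset[OF continuous_on_product_coordinates]) auto

end

text \<open>Coefficient vectors are total functions, so the coordinates beyond \<open>r\<close> are
  pinned to 0. The set is then closed in a product of compact sets, and Tychonoff's theorem
  applies.\<close>

lemma compact_coefficient_sphere:
  "compact {c :: nat \<Rightarrow> real. (\<forall>i>r. c i = 0) \<and> (\<Sum>i\<le>r. (c i)\<^sup>2) = 1}" (is "compact ?S")
proof -
  let ?B = "\<lambda>i::nat. if i \<le> r then {-1..1::real} else {0}"
  have "compactin (product_topology (\<lambda>i::nat. euclidean) UNIV) (PiE UNIV ?B)"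
    by (subst compactin_PiE) auto
  then have cB: "compact (PiE UNIV ?B)"
    by (simp add: euclidean_product_topology)
  have "closed {c :: nat \<Rightarrow> real. (\<Sum>i\<le>r. (c i)\<^sup>2) = 1}"
    by (intro closed_Collect_eq continuous_intros
        continuous_on_subset[OF continuous_on_product_coordinates]) auto
  with cB have "compact (PiE UNIV ?B \<inter> {c. (\<Sum>i\<le>r. (c i)\<^sup>2) = 1})"
    by (rule compact_Int_closed)
  moreover have "?S = PiE UNIV ?B \<inter> {c. (\<Sum>i\<le>r. (c i)\<^sup>2) = 1}"
  proof -
    have "\<bar>c i\<bar> \<le> 1" if "(\<Sum>i\<le>r. (c i)\<^sup>2) = 1" "i \<le> r" for c :: "nat \<Rightarrow> real" and i
    proof -
      have "(c i)\<^sup>2 \<le> (\<Sum>i\<le>r. (c i)\<^sup>2)" using that by (intro member_le_sum) auto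
      with that show ?thesis by (simp add: abs_square_le_1)
    qed
    then show ?thesis by (fastforce simp: PiE_def Pi_def abs_le_iff split: if_splits)
  qed
  ultimately show ?thesis by simp
qed

text \<open>By convexity it suffices to minimise over single squares, that is, to minimise a
  quotient of two quadratic forms on the unit sphere of coefficient vectors.\<close>

lemma sos_minimum_exists:
  assumes "poly_functional L" "poly_functional M"
    and pos: "\<And>p. p \<noteq> 0 \<Longrightarrow> L (p\<^sup>2) > 0"
  shows "\<exists>s\<in>sos_polys r. L s = 1 \<and> (\<forall>s'\<in>sos_polys r. L s' = 1 \<longrightarrow> M s \<le> M s')"
proof -
  interpret L: poly_functional L by fact
  interpret M: poly_functional M by fact
  let ?S = "{c :: nat \<Rightarrow> real. (\<forall>i>r. c i = 0) \<and> (\<Sum>i\<le>r. (c i)\<^sup>2) = 1}"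
  let ?P = "\<lambda>c :: nat \<Rightarrow> real. \<Sum>i\<le>r. monom (c i) i"
  have coeff_P: "coeff (?P c) i = (if i \<le> r then c i else 0)" for c i
    by (simp add: coeff_sum)
  have nz: "?P c \<noteq> 0" if "c \<in> ?S" for c
  proof
    assume "?P c = 0"
    then have "c i = 0" if "i \<le> r" for i using coeff_P[of c i] that by simp
    then have "(\<Sum>i\<le>r. (c i)\<^sup>2) = 0" by simp
    with that show False by simp
  qed
  have "(\<Sum>i\<le>r. (of_bool (i = 0) :: real)\<^sup>2) = 1"
    by (simp add: sum.atMost_shift)
  then have "(\<lambda>i. of_bool (i = 0)) \<in> ?S" by simp
  then have ne: "?S \<noteq> {}" by (intro notI) (simp only: empty_iff)
  have cont: "continuous_on ?S (\<lambda>c. M ((?P c)\<^sup>2) / L ((?P c)\<^sup>2))"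
  proof (intro continuous_on_divide L.continuous_on_square M.continuous_on_square ballI)
    fix c assume "c \<in> ?S"
    from pos[OF nz[OF this]] show "L ((?P c)\<^sup>2) \<noteq> 0" by (rule less_imp_neq[symmetric])
  qed
  obtain c0 where c0: "c0 \<in> ?S"
    and min: "\<And>c. c \<in> ?S \<Longrightarrow> M ((?P c0)\<^sup>2) / L ((?P c0)\<^sup>2) \<le> M ((?P c)\<^sup>2) / L ((?P c)\<^sup>2)"
    using continuous_attains_inf[OF compact_coefficient_sphere ne cont] by blast
  define p0 where "p0 = ?P c0"
  define \<rho> where "\<rho> = M (p0\<^sup>2) / L (p0\<^sup>2)"
  have Lp0: "L (p0\<^sup>2) > 0" using nz[OF c0] pos by (simp add: p0_def)
  \<comment> \<open>The quotient is invariant under scaling of \<open>p\<close>, so minimality on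
    the sphere extends to all nonzero polynomials of degree at most \<open>r\<close>.\<close>
  have square_ge: "\<rho> * L (p\<^sup>2) \<le> M (p\<^sup>2)" if deg: "degree p \<le> r" for p
  proof (cases "p = 0")
    case True
    then show ?thesis by (simp add: L.zero M.zero)
  next
    case False
    define k where "k = sqrt (\<Sum>i\<le>r. (coeff p i)\<^sup>2)"
    have "0 < (coeff p (degree p))\<^sup>2" using False by simp
    also have "\<dots> \<le> (\<Sum>i\<le>r. (coeff p i)\<^sup>2)" using deg by (intro member_le_sum) auto
    finally have k: "k > 0" and k2: "k\<^sup>2 = (\<Sum>i\<le>r. (coeff p i)\<^sup>2)" by (auto simp: k_def)
    define c where "c i = coeff p i / k" for i
    have "c \<in> ?S"
      using k k2 deg by (auto simp: c_def coeff_eq_0 power_divide simp flip: sum_divide_distrib)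
    have "?P c = smult (1 / k) p"
      by (intro poly_eqI) (use deg in \<open>simp add: coeff_P c_def coeff_eq_0\<close>)
    with min[OF \<open>c \<in> ?S\<close>] k
    have "\<rho> \<le> M (p\<^sup>2) / L (p\<^sup>2)"
      by (simp add: \<rho>_def p0_def L.smult_square M.smult_square power_divide)
    with pos[OF False] show ?thesis by (simp add: field_simps)
  qed
  have ge: "\<rho> \<le> M s" if s: "s \<in> sos_polys r" "L s = 1" for s
  proof -
    obtain ps where ps: "s = (\<Sum>p\<leftarrow>ps. p\<^sup>2)" and deg: "degree s \<le> 2 * r"
      using s by (auto simp: sos_polys_def)
    \<comment> \<open>Adding the inequalities for single squares handles every feasible
      \<open>s\<close>; the absence of cancellation bounds the degree of each summand.\<close>
    have "\<rho> = \<rho> * (\<Sum>p\<leftarrow>ps. L (p\<^sup>2))"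
      using s by (simp add: ps L.sum_list)
    also have "\<dots> = (\<Sum>p\<leftarrow>ps. \<rho> * L (p\<^sup>2))"
      by (simp add: sum_list_const_mult)
    also have "\<dots> \<le> (\<Sum>p\<leftarrow>ps. M (p\<^sup>2))"
      using deg degree_le_of_sum_list_squares by (intro sum_list_mono square_ge) (auto simp: ps)
    finally show ?thesis by (simp add: ps M.sum_list)
  qed
  have "degree p0 \<le> r"
    unfolding p0_def by (intro degree_sum_le order_trans[OF degree_monom_le]) auto
  then have "smult (1 / L (p0\<^sup>2)) (p0\<^sup>2) \<in> sos_polys r"
    using Lp0 by (intro smult_square_in_sos_polys) auto
  moreover have "L (smult (1 / L (p0\<^sup>2)) (p0\<^sup>2)) = 1" "M (smult (1 / L (p0\<^sup>2)) (p0\<^sup>2)) = \<rho>"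
    using Lp0 by (auto simp: L.smult M.smult \<rho>_def)
  ultimately show ?thesis using ge by blast
qed

subsection \<open>Chebyshev polynomials\<close>

fun chebyshev :: "nat \<Rightarrow> real poly" where
  "chebyshev 0 = 1"
| "chebyshev (Suc 0) = [:0, 1:]"
| "chebyshev (Suc (Suc n)) = [:0, 2:] * chebyshev (Suc n) - chebyshev n"

lemma degree_chebyshev_le: "degree (chebyshev n) \<le> n"
proof (induction n rule: chebyshev.induct)
  case (3 n)
  have "degree ([:0, 2:] * chebyshev (Suc n)) \<le> 1 + Suc n"
    using degree_mult_le[of "[:0, 2:]" "chebyshev (Suc n)"] 3 by simp
  with 3 show ?case by (auto intro!: degree_diff_le simp del: mult_pCons_left)
qed auto

lemma poly_chebyshev_cos: "poly (chebyshev n) (cos t) = cos (real n * t)"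
proof (induction n rule: chebyshev.induct)
  case (3 n)
  have "cos (real (Suc (Suc n)) * t) = cos (real (Suc n) * t + t)"
    and "cos (real n * t) = cos (real (Suc n) * t - t)"
    by (simp_all add: algebra_simps)
  with 3 show ?case by (simp add: cos_add cos_diff)
qed auto

text \<open>The same recurrence argument as for \<open>cos\<close>, now for arguments at least 1,
  where the growth takes place.\<close>

lemma poly_chebyshev_cosh: "poly (chebyshev n) (cosh t) = cosh (real n * t)"
proof (induction n rule: chebyshev.induct)
  case (3 n)
  have "cosh (real (Suc (Suc n)) * t) = cosh (real (Suc n) * t + t)"
    and "cosh (real n * t) = cosh (real (Suc n) * t - t)"
    by (simp_all add: algebra_simps)
  with 3 show ?case by (simp add: cosh_add cosh_diff)
qed auto

lemma abs_poly_chebyshev_le_1: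
  assumes "\<bar>x\<bar> \<le> 1"
  shows "\<bar>poly (chebyshev n) x\<bar> \<le> 1"
  using poly_chebyshev_cos[of n "arccos x"] assms by (simp add: cos_arccos_abs)

text \<open>Serves to show \<open>sqrt d \<le> arcosh (1 + d)\<close>, so that a distance
  \<open>d\<close> beyond 1 yields a growth exponent of order \<open>sqrt d\<close>. The proof
  averages quadratic bounds for \<open>exp x\<close> and \<open>exp (-x)\<close>.\<close>

lemma cosh_le_one_plus_square:
  fixes x :: real
  assumes "0 \<le> x" "x \<le> 1"
  shows "cosh x \<le> 1 + x\<^sup>2"
proof -
  have "exp x \<le> 1 + x + x\<^sup>2" using assms by (rule exp_bound)
  moreover have "exp (-x) \<le> 1 - x + x\<^sup>2"
  proof -
    have "exp (-x) \<le> 1 / (1 + x)"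
      using assms exp_ge_add_one_self[of x]
      by (simp add: exp_minus inverse_eq_divide frac_le)
    also have "\<dots> \<le> 1 - x + x\<^sup>2"
    proof -
      have "(1 - x + x\<^sup>2) * (1 + x) = 1 + x ^ 3" by algebra
      with assms show ?thesis by (simp add: divide_le_eq)
    qed
    finally show ?thesis .
  qed
  ultimately show ?thesis by (simp add: cosh_field_def)
qed

text \<open>Write \<open>x\<close> as \<open>cosh u\<close>; then \<open>u\<close> is at least
  \<open>sqrt d\<close>, and \<open>cosh (n * u)\<close> is at least half of
  \<open>exp (n * u)\<close>.\<close>

lemma poly_chebyshev_ge:
  assumes "0 \<le> d" "d \<le> 1" "1 + d \<le> x"
  shows "exp (real n * sqrt d) / 2 \<le> poly (chebyshev n) x"
proof -
  have "cosh (sqrt d) \<le> 1 + d"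
    using cosh_le_one_plus_square[of "sqrt d"] assms by simp
  also have "\<dots> \<le> cosh (arcosh x)" using assms by simp
  finally have "sqrt d \<le> arcosh x"
    using assms by (simp add: cosh_real_nonneg_le_iff del: cosh_arcosh_real)
  then have "exp (real n * sqrt d) / 2 \<le> exp (real n * arcosh x) / 2"
    by (simp add: mult_left_mono)
  also have "\<dots> \<le> cosh (real n * arcosh x)"
    by (simp add: cosh_field_def)
  also have "\<dots> = poly (chebyshev n) x"
    using poly_chebyshev_cosh[of n "arcosh x"] assms by simp
  finally show ?thesis .
qed

text \<open>The affine map sends \<open>[a + h, b]\<close> onto \<open>[-1, 1]\<close>, reversing the order, and
  \<open>[a, a + h / 2]\<close> beyond \<open>1 + h / (b - a)\<close>.\<close>

lemma half_needle_polynomial: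
  fixes a b h :: real
  assumes h: "0 < h" "h < b - a"
  shows "\<exists>p. degree p \<le> r \<and> (\<forall>t. a + h \<le> t \<and> t \<le> b \<longrightarrow> (poly p t)\<^sup>2 \<le> 1) \<and>
    (\<forall>t. t \<le> a + h / 2 \<longrightarrow> exp (2 * real r * sqrt (h / (b - a))) / 4 \<le> (poly p t)\<^sup>2)"
proof -
  define q where "q = [:1 + 2 * (a + h) / (b - a - h), - 2 / (b - a - h):]"
  have q: "poly q t = 1 + 2 * (a + h - t) / (b - a - h)" for t
    by (simp add: q_def diff_divide_distrib add_divide_distrib algebra_simps)
  let ?p = "pcompose (chebyshev r) q"
  have "degree ?p \<le> degree (chebyshev r) * degree q" by (rule degree_pcompose_le)
  also have "\<dots> \<le> r * 1"
    by (intro mult_le_mono degree_chebyshev_le) (simp add: q_def)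
  finally have "degree ?p \<le> r" by simp
  moreover have "(poly ?p t)\<^sup>2 \<le> 1" if "a + h \<le> t" "t \<le> b" for t
  proof -
    have "\<bar>poly q t\<bar> \<le> 1"
      using that h by (simp add: q abs_le_iff field_simps)
    then show ?thesis
      using abs_poly_chebyshev_le_1 by (simp add: poly_pcompose abs_square_le_1)
  qed
  moreover have "exp (2 * real r * sqrt (h / (b - a))) / 4 \<le> (poly ?p t)\<^sup>2"
    if "t \<le> a + h / 2" for t
  proof -
    \<comment> \<open>The quotient \<open>h / (b - a)\<close> is below 1, as
      \<open>poly_chebyshev_ge\<close> requires, whereas \<open>h / (b - a - h)\<close> may exceed
      1.\<close>
    have "h / (b - a) \<le> h / (b - a - h)"
      using h by (intro divide_left_mono mult_pos_pos) auto
    also have "\<dots> \<le> 2 * (a + h - t) / (b - a - h)"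
      using that h by (intro divide_right_mono) auto
    finally have "1 + h / (b - a) \<le> poly q t" by (simp add: q)
    then have "exp (real r * sqrt (h / (b - a))) / 2 \<le> poly ?p t"
      using h poly_chebyshev_ge[of "h / (b - a)" "poly q t" r] by (simp add: poly_pcompose)
    then have "(exp (real r * sqrt (h / (b - a))) / 2)\<^sup>2 \<le> (poly ?p t)\<^sup>2"
      by (intro power_mono) auto
    then show ?thesis
      by (simp add: power_divide mult.assoc flip: exp_double)
  qed
  ultimately show ?thesis by blast
qed

subsection \<open>Integration over compact sets\<close>

lemma integrable_lebesgue_on_compact:
  fixes g :: "'a::euclidean_space \<Rightarrow> real"
  assumes "compact K" "continuous_on K g"
  shows "integrable (lebesgue_on K) g"
proof -
  have K: "K \<in> lmeasurable" using assms(1) by (rule lmeasurable_compact)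
  have "compact (g ` K)" using assms by (rule compact_continuous_image[rotated])
  then obtain B where "\<And>x. x \<in> K \<Longrightarrow> norm (g x) \<le> B"
    using compact_imp_bounded bounded_iff by (metis image_eqI)
  with K assms show ?thesis
    by (intro finite_measure.integrable_const_bound[of _ _ B] finite_measure_lebesgue_on
        continuous_imp_measurable_on_sets_lebesgue AE_I2) (auto simp: fmeasurableD)
qed

text \<open>Induction on the construction of \<open>f\<close>. In the product case bounds on the
  factors are used as well, which compactness of \<open>K\<close> provides.\<close>

lemma real_polynomial_function_lipschitz_on_compact:
  assumes "real_polynomial_function f" "compact K"
  shows "\<exists>B. B-lipschitz_on K f"
  using assms(1)
proof induction
  case (linear f)
  then show ?case
    by (metis bounded_linear.lipschitz_boundE)
next
  case (const c)
  then show ?case by (auto intro: lipschitz_intros)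
next
  case (add f g)
  then show ?case by (blast intro: lipschitz_on_add)
next
  case (mult f g)
  then obtain A B where A: "A-lipschitz_on K f" and B: "B-lipschitz_on K g" by blast
  have "bounded (f ` K)" "bounded (g ` K)"
    using A B assms(2)
    by (auto intro!: compact_imp_bounded compact_continuous_image dest: lipschitz_on_continuous_on)
  then obtain F G where F: "\<And>x. x \<in> K \<Longrightarrow> \<bar>f x\<bar> \<le> F" and G: "\<And>x. x \<in> K \<Longrightarrow> \<bar>g x\<bar> \<le> G"
    unfolding bounded_iff by (metis image_eqI real_norm_def)
  show ?case
  \<comment> \<open>A point of \<open>K\<close> is used to see that the bounds \<open>F\<close> and
    \<open>G\<close> are nonnegative.\<close>
  proof (cases "K = {}")
    case True
    then show ?thesis by (metis lipschitz_on_empty_iff order_refl)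
  next
    case False
    then have "0 \<le> F" "0 \<le> G" using F G abs_ge_zero order_trans by blast+
    have "(F * B + G * A)-lipschitz_on K (\<lambda>x. f x * g x)"
    proof (rule lipschitz_onI)
      fix x y assume xy: "x \<in> K" "y \<in> K"
      have "f x * g x - f y * g y = f x * (g x - g y) + g y * (f x - f y)" by algebra
      then have "dist (f x * g x) (f y * g y) \<le> \<bar>f x\<bar> * dist (g x) (g y) + \<bar>g y\<bar> * dist (f x) (f y)"
        by (metis abs_mult abs_triangle_ineq dist_real_def)
      also have "\<dots> \<le> F * (B * dist x y) + G * (A * dist x y)"
        using xy F G \<open>0 \<le> F\<close> \<open>0 \<le> G\<close> lipschitz_onD[OF A] lipschitz_onD[OF B]
        by (intro add_mono mult_mono) auto
      finally show "dist (f x * g x) (f y * g y) \<le> (F * B + G * A) * dist x y"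
        by (simp add: algebra_simps)
    qed (use \<open>0 \<le> F\<close> \<open>0 \<le> G\<close> lipschitz_on_nonneg[OF A] lipschitz_on_nonneg[OF B] in auto)
    then show ?thesis by blast
  qed
qed

text \<open>A Markov inequality: compare \<open>g\<close> with \<open>c\<close> times the indicator
  of \<open>A\<close>.\<close>

lemma integral_lebesgue_on_ge_measure:
  fixes g :: "'a::euclidean_space \<Rightarrow> real"
  assumes "compact K" "continuous_on K g" "\<And>x. x \<in> K \<Longrightarrow> 0 \<le> g x"
    and A: "A \<in> sets lebesgue" "A \<subseteq> K" "\<And>x. x \<in> A \<Longrightarrow> c \<le> g x"
  shows "c * measure lebesgue A \<le> (LINT x|lebesgue_on K. g x)"
proof -
  have K: "K \<in> sets lebesgue" using assms(1) by (simp add: lmeasurable_compact fmeasurableD)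
  interpret finite_measure "lebesgue_on K"
    using assms(1) by (intro finite_measure_lebesgue_on lmeasurable_compact)
  have A': "A \<in> sets (lebesgue_on K)" using A K by (simp add: sets_restrict_space_iff)
  have "c * measure lebesgue A = (LINT x|lebesgue_on K. c * indicator A x)"
    using A K by (simp add: measure_restrict_space Int_absorb2)
  also have "\<dots> \<le> (LINT x|lebesgue_on K. g x)"
  proof (rule integral_mono)
    show "integrable (lebesgue_on K) (\<lambda>x. c * indicator A x)"
      using A' by (intro integrable_mult_right integrable_real_indicator) (auto simp: less_top[symmetric])
    show "c * indicator A x \<le> g x" if "x \<in> space (lebesgue_on K)" for x
      using that assms by (cases "x \<in> A") auto
  qed (use assms integrable_lebesgue_on_compact in auto)
  finally show ?thesis .
qed

subsection \<open>The push-forward bounds\<close>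

text \<open>\<open>volume_pos\<close> keeps only the qualitative content of the geometric condition,
  at every radius; the rate in \<open>\<delta>\<close> enters later through a lower bound on the
  volume of a sublevel set.\<close>

locale pushforward_setting =
  fixes K :: "(real ^ 'n) set" and f :: "real ^ 'n \<Rightarrow> real"
  assumes nonempty: "K \<noteq> {}" and compact: "compact K" and connected: "connected K"
    and continuous: "continuous_on K f"
    and volume_pos: "\<And>x \<delta>. x \<in> K \<Longrightarrow> \<delta> > 0 \<Longrightarrow> measure lebesgue (K \<inter> cball x \<delta>) > 0"
begin

lemma fmin_attained: "\<exists>x0\<in>K. f x0 = fmin K f \<and> (\<forall>x\<in>K. fmin K f \<le> f x)"
proof -
  obtain x0 where x0: "x0 \<in> K" "\<forall>x\<in>K. f x0 \<le> f x"
    using continuous_attains_inf[OF compact nonempty continuous] by blast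
  then have "fmin K f = f x0"
    unfolding fmin_def by (intro Least_equality) auto
  with x0 show ?thesis by metis
qed

lemma continuous_on_poly_comp: "continuous_on K (\<lambda>x. poly p (f x))"
  by (intro continuous_intros continuous)

lemma poly_functional_weighted_integral:
  assumes "continuous_on K g"
  shows "poly_functional (\<lambda>p. LINT x|lebesgue_on K. g x * poly p (f x))"
proof
  have int: "integrable (lebesgue_on K) (\<lambda>x. g x * poly p (f x))" for p
    by (intro integrable_lebesgue_on_compact compact continuous_intros assms continuous)
  show "(LINT x|lebesgue_on K. g x * poly (p + q) (f x)) =
      (LINT x|lebesgue_on K. g x * poly p (f x)) + (LINT x|lebesgue_on K. g x * poly q (f x))" for p q
    using int[of p] int[of q] by (simp add: algebra_simps)
  show "(LINT x|lebesgue_on K. g x * poly (smult c p) (f x)) =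
      c * (LINT x|lebesgue_on K. g x * poly p (f x))" for c p
    by (simp add: mult.left_commute)
qed

lemma poly_functional_integral: "poly_functional (\<lambda>p. LINT x|lebesgue_on K. poly p (f x))"
  using poly_functional_weighted_integral[of "\<lambda>_. 1"] by simp

text \<open>By continuity \<open>g\<close> stays above \<open>g x / 2\<close> on the part of
  \<open>K\<close> in a small ball around \<open>x\<close>, and that part has positive
  volume.\<close>

lemma integral_pos:
  fixes g :: "real ^ 'n \<Rightarrow> real"
  assumes g: "continuous_on K g" "\<And>x. x \<in> K \<Longrightarrow> 0 \<le> g x" and x: "x \<in> K" "0 < g x"
  shows "0 < (LINT y|lebesgue_on K. g y)"
proof -
  obtain d where "d > 0" and d: "\<And>y. y \<in> K \<Longrightarrow> dist y x < d \<Longrightarrow> dist (g y) (g x) < g x / 2"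
    using g(1) x unfolding continuous_on_iff by (metis half_gt_zero)
  have "0 < g x / 2 * measure lebesgue (K \<inter> cball x (d / 2))"
    using volume_pos[OF x(1)] \<open>d > 0\<close> x by simp
  also have "\<dots> \<le> (LINT y|lebesgue_on K. g y)"
  proof (rule integral_lebesgue_on_ge_measure[OF compact g])
    show "K \<inter> cball x (d / 2) \<in> sets lebesgue"
      using compact by (intro fmeasurableD lmeasurable_compact compact_Int_closed closed_cball)
    show "g x / 2 \<le> g y" if "y \<in> K \<inter> cball x (d / 2)" for y
    proof -
      have "dist y x < d" using that \<open>d > 0\<close> by (simp add: dist_commute)
      then have "\<bar>g y - g x\<bar> < g x / 2" using d that by (simp add: dist_real_def)
      then show ?thesis by linarith
    qed
  qed auto
  finally show ?thesis .
qed

text \<open>Treated apart because a nonzero \<open>p\<close> may vanish at the single value of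
  \<open>f\<close>, so the integral of its square need not be positive. Every normalised
  \<open>s\<close> has objective value \<open>a\<close>, and a suitable constant is
  feasible.\<close>

lemma pfm_eq_fmin_if_constant:
  assumes "\<And>x. x \<in> K \<Longrightarrow> f x = a"
  shows "pfm K f r = fmin K f"
proof -
  have a: "fmin K f = a" using fmin_attained assms by auto
  have val: "(LINT x|lebesgue_on K. f x * poly s (f x)) = a"
    if "(LINT x|lebesgue_on K. poly s (f x)) = 1" for s
  proof -
    have "(LINT x|lebesgue_on K. f x * poly s (f x)) = (LINT x|lebesgue_on K. a * poly s (f x))"
      using assms by (intro Bochner_Integration.integral_cong) auto
    with that show ?thesis by simp
  qed
  define V where "V = (LINT x|lebesgue_on K. (1::real))"
  obtain x where "x \<in> K" using nonempty by blast
  then have "V > 0" unfolding V_def by (rule integral_pos[rotated 2]) simp_all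
  define s where "s = smult (1 / V) (1\<^sup>2)"
  have s: "s \<in> sos_polys r"
    unfolding s_def using \<open>V > 0\<close> by (intro smult_square_in_sos_polys) auto
  have s1: "(LINT x|lebesgue_on K. poly s (f x)) = 1"
    using \<open>V > 0\<close> poly_functional.smult[OF poly_functional_integral, of "1 / V" "1\<^sup>2"]
    by (simp add: V_def s_def)
  have "pfm K f r = a"
    unfolding pfm_def
  proof (rule Least_equality)
    show "a \<in> {(LINT x|lebesgue_on K. f x * poly s (f x)) | s.
        s \<in> sos_polys r \<and> (LINT x|lebesgue_on K. poly s (f x)) = 1}"
      by (intro CollectI exI[of _ s] conjI s s1 val[OF s1, symmetric])
    show "a \<le> v" if "v \<in> {(LINT x|lebesgue_on K. f x * poly s (f x)) | s.
        s \<in> sos_polys r \<and> (LINT x|lebesgue_on K. poly s (f x)) = 1}" for v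
      using that by (elim CollectE exE conjE) (simp only: val)
  qed
  with a show ?thesis by simp
qed

section \<open>Nonconstant \<open>f\<close>: attainment of the minimum and bounds on it\<close>

context
  fixes b :: real
  assumes upper: "\<And>x. x \<in> K \<Longrightarrow> f x \<le> b" and nonconstant: "\<not> f constant_on K"
begin

text \<open>Connectedness enters here: the range of a nonconstant \<open>f\<close> is infinite, so
  \<open>p\<close>, having finitely many roots, is nonzero somewhere on it.\<close>

lemma integral_square_pos:
  assumes "p \<noteq> 0"
  shows "0 < (LINT x|lebesgue_on K. poly (p\<^sup>2) (f x))"
proof -
  have "\<exists>x\<in>K. poly p (f x) \<noteq> 0"
  proof (rule ccontr)
    assume "\<not> ?thesis"
    then have "f ` K \<subseteq> {t. poly p t = 0}" by auto
    then have "finite (f ` K)" using poly_roots_finite[OF assms] by (rule finite_subset)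
    moreover have "connected (f ` K)" using continuous connected by (rule connected_continuous_image)
    ultimately have "f ` K = {} \<or> (\<exists>a. f ` K = {a})" using connected_finite_iff_sing by blast
    then show False using nonempty nonconstant by (auto simp: constant_on_def)
  qed
  then obtain x where "x \<in> K" "poly p (f x) \<noteq> 0" by blast
  then show ?thesis
    by (intro integral_pos[of _ x] continuous_on_poly_comp) simp_all
qed

text \<open>Existence of a minimiser ensures that the \<open>LEAST\<close> in \<open>pfm\<close>
  denotes the actual minimum.\<close>

lemma pfm_attained:
  "\<exists>s\<in>sos_polys r. (LINT x|lebesgue_on K. poly s (f x)) = 1 \<and>
     pfm K f r = (LINT x|lebesgue_on K. f x * poly s (f x)) \<and>
     (\<forall>s'\<in>sos_polys r. (LINT x|lebesgue_on K. poly s' (f x)) = 1 \<longrightarrow>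
        pfm K f r \<le> (LINT x|lebesgue_on K. f x * poly s' (f x)))"
proof -
  obtain s where s: "s \<in> sos_polys r" "(LINT x|lebesgue_on K. poly s (f x)) = 1"
    and min: "\<forall>s'\<in>sos_polys r. (LINT x|lebesgue_on K. poly s' (f x)) = 1 \<longrightarrow>
      (LINT x|lebesgue_on K. f x * poly s (f x)) \<le> (LINT x|lebesgue_on K. f x * poly s' (f x))"
    using sos_minimum_exists[OF poly_functional_integral
        poly_functional_weighted_integral[OF continuous] integral_square_pos] by blast
  have "pfm K f r = (LINT x|lebesgue_on K. f x * poly s (f x))"
    unfolding pfm_def using s min by (intro Least_equality) auto
  with s min show ?thesis by auto
qed

text \<open>Makes the difference nonnegative, so that an upper bound alone controls its absolute
  value.\<close>

lemma fmin_le_pfm: "fmin K f \<le> pfm K f r"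
proof -
  obtain s where s: "s \<in> sos_polys r" "(LINT x|lebesgue_on K. poly s (f x)) = 1"
    and pfm: "pfm K f r = (LINT x|lebesgue_on K. f x * poly s (f x))"
    using pfm_attained by blast
  obtain ps where "s = (\<Sum>p\<leftarrow>ps. p\<^sup>2)" using s(1) by (auto simp: sos_polys_def)
  then have nonneg: "0 \<le> poly s t" for t
    by (induction ps arbitrary: s) auto
  have "fmin K f = (LINT x|lebesgue_on K. fmin K f * poly s (f x))"
    using s by simp
  also have "\<dots> \<le> pfm K f r"
    unfolding pfm
  proof (rule integral_mono)
    show "fmin K f * poly s (f x) \<le> f x * poly s (f x)" if "x \<in> space (lebesgue_on K)" for x
      using that fmin_attained nonneg by (auto intro: mult_right_mono)
  qed (intro integrable_lebesgue_on_compact compact continuous_intros continuous)+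
  finally show ?thesis .
qed

lemma pfm_le_square_quotient:
  assumes "degree p \<le> r" "p \<noteq> 0"
  shows "pfm K f r \<le> (LINT x|lebesgue_on K. f x * poly (p\<^sup>2) (f x)) /
    (LINT x|lebesgue_on K. poly (p\<^sup>2) (f x))"
proof -
  let ?Z = "LINT x|lebesgue_on K. poly (p\<^sup>2) (f x)"
  have Z: "?Z > 0" using assms(2) by (rule integral_square_pos)
  let ?s = "smult (1 / ?Z) (p\<^sup>2)"
  have "?s \<in> sos_polys r" using assms Z by (intro smult_square_in_sos_polys) auto
  moreover have "(LINT x|lebesgue_on K. poly ?s (f x)) = 1"
    using Z poly_functional.smult[OF poly_functional_integral, of "1 / ?Z" "p\<^sup>2"] by simp
  ultimately have "pfm K f r \<le> (LINT x|lebesgue_on K. f x * poly ?s (f x))"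
    using pfm_attained by blast
  then show ?thesis
    using poly_functional.smult[OF poly_functional_weighted_integral[OF continuous], of "1 / ?Z" "p\<^sup>2"]
    by simp
qed

text \<open>Points with \<open>f x \<le> a + h\<close> add no positive excess over the level
  \<open>a + h\<close>; elsewhere the square is at most 1, so the total excess is at most
  \<open>(b - a) * measure lebesgue K\<close>. It is divided by the mass of the square, which is at
  least \<open>E / 4 * m\<close>.\<close>

lemma pfm_le_sublevel_volume:
  fixes h m :: real
  defines "a \<equiv> fmin K f"
  assumes h: "0 < h" "h < b - a"
    and m: "0 < m" "m \<le> measure lebesgue {x \<in> K. f x \<le> a + h / 2}"
  shows "pfm K f r \<le> a + h +
    4 * (b - a) * measure lebesgue K / m * exp (- (2 * real r * sqrt (h / (b - a))))"
proof -
  define E where "E = exp (2 * real r * sqrt (h / (b - a)))"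
  obtain p where deg: "degree p \<le> r"
    and small: "\<And>t. a + h \<le> t \<Longrightarrow> t \<le> b \<Longrightarrow> (poly p t)\<^sup>2 \<le> 1"
    and large: "\<And>t. t \<le> a + h / 2 \<Longrightarrow> E / 4 \<le> (poly p t)\<^sup>2"
    using half_needle_polynomial[OF h, of r] unfolding E_def by blast
  have "E > 0" by (simp add: E_def)
  have "p \<noteq> 0" using large[of a] h \<open>E > 0\<close> by auto
  define Z where "Z = (LINT x|lebesgue_on K. poly (p\<^sup>2) (f x))"
  have int: "integrable (lebesgue_on K) (\<lambda>x. g x * poly q (f x))" if "continuous_on K g" for g q
    by (intro integrable_lebesgue_on_compact compact continuous_intros continuous that)
  have "closed {x \<in> K. f x \<le> a + h / 2}"
    using continuous_closed_preimage[OF continuous compact_imp_closed[OF compact] closed_atMost]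
    by (simp add: vimage_def Int_def)
  then have "{x \<in> K. f x \<le> a + h / 2} \<in> sets lebesgue"
    by (simp add: borel_closed)
  then have "E / 4 * measure lebesgue {x \<in> K. f x \<le> a + h / 2} \<le> Z"
    unfolding Z_def using large continuous_on_poly_comp[of "p\<^sup>2"]
    by (intro integral_lebesgue_on_ge_measure compact) auto
  then have Z: "E / 4 * m \<le> Z"
    using m \<open>E > 0\<close> by (meson mult_left_mono order_trans divide_nonneg_nonneg less_imp_le zero_le_numeral)
  have "Z > 0" unfolding Z_def using \<open>p \<noteq> 0\<close> by (rule integral_square_pos)
  have "(LINT x|lebesgue_on K. f x * poly (p\<^sup>2) (f x)) - (a + h) * Z =
      (LINT x|lebesgue_on K. (f x - (a + h)) * poly (p\<^sup>2) (f x))"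
    using int[OF continuous, of "p\<^sup>2"] int[of "\<lambda>_. a + h" "p\<^sup>2"]
    by (simp add: Z_def left_diff_distrib)
  also have "\<dots> \<le> (LINT x|lebesgue_on K. b - a)"
  proof (rule integral_mono)
    show "(f x - (a + h)) * poly (p\<^sup>2) (f x) \<le> b - a" if "x \<in> space (lebesgue_on K)" for x
    proof (cases "f x \<le> a + h")
      case True
      then have "(f x - (a + h)) * poly (p\<^sup>2) (f x) \<le> 0"
        by (intro mult_nonpos_nonneg) auto
      with h show ?thesis by linarith
    next
      case False
      then have "(f x - (a + h)) * poly (p\<^sup>2) (f x) \<le> (f x - (a + h)) * 1"
        using that small[of "f x"] upper[of x] by (intro mult_left_mono) auto
      also have "\<dots> \<le> b - a" using that upper[of x] h by simp
      finally show ?thesis .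
    qed
  qed (intro integrable_lebesgue_on_compact compact continuous_intros continuous)+
  also have "\<dots> = (b - a) * measure lebesgue K"
    using compact
    by (simp add: measure_restrict_space lmeasurable_compact fmeasurableD)
  finally have "(LINT x|lebesgue_on K. f x * poly (p\<^sup>2) (f x)) \<le> (a + h) * Z + (b - a) * measure lebesgue K"
    by simp
  then have "(LINT x|lebesgue_on K. f x * poly (p\<^sup>2) (f x)) / Z \<le> a + h + (b - a) * measure lebesgue K / Z"
    using \<open>Z > 0\<close> by (simp add: field_simps)
  also have "(b - a) * measure lebesgue K / Z \<le> (b - a) * measure lebesgue K / (E / 4 * m)"
    using Z h m \<open>E > 0\<close> \<open>Z > 0\<close> by (intro divide_left_mono mult_nonneg_nonneg mult_pos_pos) auto
  also have "\<dots> = 4 * (b - a) * measure lebesgue K / m * exp (- (2 * real r * sqrt (h / (b - a))))"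
    by (simp add: E_def exp_minus field_simps)
  finally show ?thesis
    using pfm_le_square_quotient[OF deg \<open>p \<noteq> 0\<close>] by (simp add: Z_def)
qed

end

end

section \<open>Choice of \<open>h\<close> and the asymptotic estimate\<close>

theorem theorem1:
  fixes K :: "(real ^ 'n) set" and f :: "real ^ 'n \<Rightarrow> real"
  assumes "K \<noteq> {}" and "compact K" and "connected K"
    and "\<exists>\<epsilon> \<eta> N :: real. \<epsilon> > 0 \<and> \<eta> > 0 \<and> N \<ge> real CARD('n) \<and>
           (\<forall>x\<in>K. \<forall>\<delta>. 0 < \<delta> \<and> \<delta> \<le> \<epsilon> \<longrightarrow>
              measure lebesgue (K \<inter> cball x \<delta>)
                \<ge> \<eta> * \<delta> powr N * measure lebesgue (cball (0 :: real ^ 'n) 1))"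
    and "real_polynomial_function f"
  shows "(\<lambda>r. pfm K f r - fmin K f) \<in> O(\<lambda>r. (ln (real r))\<^sup>2 / (real r)\<^sup>2)"
proof -
  define \<omega> where "\<omega> = measure lebesgue (cball (0 :: real ^ 'n) 1)"
  have "\<omega> > 0" by (simp add: \<omega>_def content_cball_pos)
  obtain \<epsilon> \<eta> N :: real where "\<epsilon> > 0" "\<eta> > 0" and N: "N \<ge> real CARD('n)"
    and vol: "\<And>x \<delta>. x \<in> K \<Longrightarrow> 0 < \<delta> \<Longrightarrow> \<delta> \<le> \<epsilon> \<Longrightarrow> \<eta> * \<delta> powr N * \<omega> \<le> measure lebesgue (K \<inter> cball x \<delta>)"
    using assms(4) unfolding \<omega>_def by metis
  have "N > 0" using N by (rule less_le_trans[rotated]) simp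
  have cball_meas: "K \<inter> cball x \<delta> \<in> lmeasurable" for x \<delta>
    using assms(2) by (intro lmeasurable_compact compact_Int_closed closed_cball)
  have cont: "continuous_on K f"
    using assms(5) continuous_real_polymonial_function continuous_at_imp_continuous_on by blast
  interpret pushforward_setting K f
  proof
    fix x \<delta> assume "x \<in> K" "\<delta> > (0::real)"
    \<comment> \<open>The geometric condition speaks of radii up to \<open>\<epsilon>\<close> only;
      larger balls contain the truncated one.\<close>
    define \<delta>' where "\<delta>' = min \<delta> \<epsilon>"
    have "0 < \<eta> * \<delta>' powr N * \<omega>"
      using \<open>\<delta> > 0\<close> \<open>\<epsilon> > 0\<close> \<open>\<eta> > 0\<close> \<open>\<omega> > 0\<close> by (simp add: \<delta>'_def)
    also have "\<dots> \<le> measure lebesgue (K \<inter> cball x \<delta>')"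
      using \<open>x \<in> K\<close> \<open>\<delta> > 0\<close> \<open>\<epsilon> > 0\<close> by (intro vol) (auto simp: \<delta>'_def)
    also have "\<dots> \<le> measure lebesgue (K \<inter> cball x \<delta>)"
      using cball_meas by (intro measure_mono_fmeasurable) (auto simp: \<delta>'_def)
    finally show "0 < measure lebesgue (K \<inter> cball x \<delta>)" .
  qed (use assms cont in auto)
  show ?thesis
  proof (cases "f constant_on K")
    case True
    then have "pfm K f r = fmin K f" for r
      using pfm_eq_fmin_if_constant by (auto simp: constant_on_def)
    then show ?thesis by simp
  next
    case False
    define a where "a = fmin K f"
    obtain x0 where x0: "x0 \<in> K" "f x0 = a" and lower: "\<And>x. x \<in> K \<Longrightarrow> a \<le> f x"
      using fmin_attained unfolding a_def by blast
    obtain b where upper: "\<And>x. x \<in> K \<Longrightarrow> f x \<le> b"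
      using continuous_attains_sup[OF compact nonempty cont] by blast
    have "\<exists>x\<in>K. f x \<noteq> a" using False by (auto simp: constant_on_def)
    then have "a < b" using lower upper by fastforce
    define D where "D = b - a"
    have "D > 0" using \<open>a < b\<close> by (simp add: D_def)
    obtain B' where "B'-lipschitz_on K f"
      using real_polynomial_function_lipschitz_on_compact assms(2,5) by blast
    then have lip: "(max B' 1)-lipschitz_on K f"
      by (rule lipschitz_on_mono) auto
    \<comment> \<open>Raising the Lipschitz constant to at least 1 permits division by
      \<open>B\<close>.\<close>
    define B where "B = max B' 1"
    have "B > 0" by (simp add: B_def)
    text \<open>With this \<open>A\<close> the exponential decay of the needle outside \<open>f \<le> a + h\<close> beats the
      volume loss of order \<open>r powr (- 2 * N)\<close> by a factor \<open>1 / r\<^sup>2\<close>.\<close>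
    define A where "A = N + 1"
    \<comment> \<open>Chosen so that \<open>sqrt (h r / D) = A * (ln r / r)\<close>, which turns the
      exponential of the needle bound into \<open>r powr (- 2 * A)\<close>.\<close>
    define h where "h r = D * (A * (ln (real r) / real r))\<^sup>2" for r
    \<comment> \<open>The radius \<open>h r / (2 * B)\<close> equals
      \<open>\<kappa> * (ln r / r)\<^sup>2\<close>.\<close>
    define \<kappa> where "\<kappa> = D * A\<^sup>2 / (2 * B)"
    have "A > 0" using \<open>N > 0\<close> by (simp add: A_def)
    have "\<kappa> > 0" using \<open>A > 0\<close> \<open>D > 0\<close> \<open>B > 0\<close> by (simp add: \<kappa>_def)
    define C where "C = 4 * D * measure lebesgue K / (\<eta> * \<kappa> powr N * \<omega>)"
    have "C \<ge> 0"
      using \<open>D > 0\<close> \<open>\<eta> > 0\<close> \<open>\<omega> > 0\<close> by (simp add: C_def)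
    have "h \<longlonglongrightarrow> D * (A * 0)\<^sup>2"
      unfolding h_def by (intro tendsto_intros lim_ln_over_n)
    then have h0: "h \<longlonglongrightarrow> 0" by simp
    \<comment> \<open>The first bound keeps \<open>h r\<close> in the range allowed for the needle;
      the second keeps the radius \<open>h r / (2 * B)\<close> below
      \<open>\<epsilon>\<close>.\<close>
    have "eventually (\<lambda>r. h r < D) sequentially" "eventually (\<lambda>r. h r < 2 * B * \<epsilon>) sequentially"
      using \<open>D > 0\<close> \<open>B > 0\<close> \<open>\<epsilon> > 0\<close> by (auto intro!: order_tendstoD(2)[OF h0])
    then have "eventually (\<lambda>r. norm (pfm K f r - fmin K f) \<le>
        (D * A\<^sup>2 + C) * norm ((ln (real r))\<^sup>2 / (real r)\<^sup>2)) sequentially"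
      using eventually_ge_at_top[of 3]
    proof eventually_elim
      case (elim r)
      have "exp 1 \<le> real r" using elim(3) exp_le by linarith
      then have ln1: "1 \<le> ln (real r)" using elim(3) by (simp add: ln_ge_iff)
      have h_pos: "0 < h r" using \<open>D > 0\<close> \<open>A > 0\<close> ln1 elim(3) by (simp add: h_def)
      \<comment> \<open>Within this radius the Lipschitz bound lets \<open>f\<close> rise by at most
        \<open>h r / 2\<close>.\<close>
      define \<delta> where "\<delta> = h r / (2 * B)"
      have \<delta>: "0 < \<delta>" "\<delta> \<le> \<epsilon>"
        using h_pos \<open>B > 0\<close> elim(2) by (auto simp: \<delta>_def field_simps)
      \<comment> \<open>The volume bound at the smaller radius \<open>\<kappa> / r\<^sup>2\<close>,
        free of the logarithm, so that \<open>m\<close> is a constant times a power of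
        \<open>r\<close>.\<close>
      define m where "m = \<eta> * (\<kappa> powr N * real r powr (- 2 * N)) * \<omega>"
      have "m > 0" using \<open>\<eta> > 0\<close> \<open>\<kappa> > 0\<close> \<open>\<omega> > 0\<close> elim(3) by (simp add: m_def)
      have "\<kappa> / (real r)\<^sup>2 \<le> \<kappa> * ((ln (real r))\<^sup>2 / (real r)\<^sup>2)"
        using ln1 \<open>\<kappa> > 0\<close> by (simp add: divide_right_mono)
      also have "\<dots> = \<delta>"
        by (simp add: \<delta>_def h_def \<kappa>_def power_mult_distrib power_divide mult_ac)
      finally have "(\<kappa> / (real r)\<^sup>2) powr N \<le> \<delta> powr N"
        using \<open>\<kappa> > 0\<close> \<open>N > 0\<close> by (intro powr_mono2) auto
      moreover have "(\<kappa> / (real r)\<^sup>2) powr N = \<kappa> powr N * real r powr (- 2 * N)"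
      proof -
        have "\<kappa> / (real r)\<^sup>2 = \<kappa> * real r powr (- 2)"
          using elim(3) by (simp add: powr_minus divide_inverse)
        then show ?thesis using \<open>\<kappa> > 0\<close> by (simp add: powr_mult powr_powr)
      qed
      ultimately have "m \<le> \<eta> * \<delta> powr N * \<omega>"
        using \<open>\<eta> > 0\<close> \<open>\<omega> > 0\<close> by (simp add: m_def)
      also have "\<dots> \<le> measure lebesgue (K \<inter> cball x0 \<delta>)"
        using vol x0 \<delta> by blast
      also have "\<dots> \<le> measure lebesgue {x \<in> K. f x \<le> a + h r / 2}"
      proof (rule measure_mono_fmeasurable)
        have "{x \<in> K. f x \<le> a + h r / 2} = K \<inter> f -` {..a + h r / 2}" by auto
        moreover have "closed (K \<inter> f -` {..a + h r / 2})"
          by (intro continuous_closed_preimage cont compact_imp_closed compact closed_atMost)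
        ultimately show "{x \<in> K. f x \<le> a + h r / 2} \<in> lmeasurable"
          using compact by (metis compact_Int_closed inf.left_idem lmeasurable_compact)
        have "f x \<le> a + h r / 2" if "x \<in> K" "dist x0 x \<le> \<delta>" for x
        proof -
          have "dist (f x) (f x0) \<le> B * dist x x0"
            using lipschitz_onD[OF lip that(1) x0(1)] by (simp add: B_def)
          also have "\<dots> \<le> B * \<delta>"
            using that \<open>B > 0\<close> by (simp add: dist_commute)
          also have "\<dots> = h r / 2" using \<open>B > 0\<close> by (simp add: \<delta>_def)
          finally have "\<bar>f x - a\<bar> \<le> h r / 2" using x0 by (simp add: dist_real_def)
          then show ?thesis by linarith
        qed
        then show "K \<inter> cball x0 \<delta> \<subseteq> {x \<in> K. f x \<le> a + h r / 2}" by auto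
      qed (use cball_meas in \<open>simp add: fmeasurableD\<close>)
      finally have m_le: "m \<le> measure lebesgue {x \<in> K. f x \<le> a + h r / 2}" .
      have "pfm K f r \<le> a + h r +
          4 * D * measure lebesgue K / m * exp (- (2 * real r * sqrt (h r / D)))"
        using pfm_le_sublevel_volume[of b "h r" m r] upper False h_pos elim(1) \<open>m > 0\<close> m_le
        by (simp add: a_def D_def)
      also have "sqrt (h r / D) = A * (ln (real r) / real r)"
        using \<open>D > 0\<close> \<open>A > 0\<close> ln1 by (simp add: h_def)
      also have "exp (- (2 * real r * (A * (ln (real r) / real r)))) = real r powr (- 2 * A)"
        using elim(3) by (simp add: powr_def)
      also have "4 * D * measure lebesgue K / m * real r powr (- 2 * A) = C / (real r)\<^sup>2"
      proof -
        have "real r powr (- 2 * A) = real r powr (- 2 * N) / (real r)\<^sup>2"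
        proof -
          have "real r powr (- 2 * A) = real r powr (- 2 * N) * real r powr (- 2)"
            by (simp add: A_def flip: powr_add)
          then show ?thesis using elim(3) by (simp add: powr_minus divide_inverse)
        qed
        moreover have "real r powr (- 2 * N) > 0" using elim(3) by simp
        ultimately show ?thesis
          by (simp add: C_def m_def del: powr_gt_zero)
      qed
      also have "C / (real r)\<^sup>2 \<le> C * ((ln (real r))\<^sup>2 / (real r)\<^sup>2)"
        using mult_left_mono[OF divide_right_mono[OF one_le_power[OF ln1, of 2], of "(real r)\<^sup>2"] \<open>C \<ge> 0\<close>]
        by simp
      also have "a + h r + C * ((ln (real r))\<^sup>2 / (real r)\<^sup>2) =
          a + (D * A\<^sup>2 + C) * ((ln (real r))\<^sup>2 / (real r)\<^sup>2)"
        by (simp add: h_def power_mult_distrib power_divide algebra_simps add_divide_distrib)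
      finally show ?case
        using fmin_le_pfm[of b r] upper False by (simp add: a_def)
    qed
    then show ?thesis by (rule bigoI)
  qed
qed

end
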